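(* Let $M=[x_-,x_+]$ be the support of a stationary distribution of the random difference equation with additive bounded noise $y_{t+1}=f(y_t)+\xi_t$, and let $\phi$ be its stationary density. Assume that $f_-'$ is monotone near $x_-$ (i.e. on some neighbourhood of $x_-$), that $\lambda:=f_-'(x_-)<1$, and that the noise density $p$ satisfies $p(-\varepsilon)>0$. Then, as $x\to x_-^+$, $$\log\phi(x)=\frac{1}{2\log\lambda}\log^2(x-x_-)-\frac{2}{2\log\lambda}\,\log(x-x_-)\cdot\log\log\left(\frac{1}{x-x_-}\right)+\mathcal{O}\big(\log(x-x_-)\big).$$
   Context: Setting and standing assumptions. Let $\varepsilon>0$ and let $f:\mathbb{R}\to\mathbb{R}$ be an order-preserving $C^2$-diffeomorphism. Consider $y_{t+1}=f(y_t)+\xi_t$, $t\in\mathbb{N}$, where $(\xi_t)_{t\in\mathbb{N}}$ are i.i.d. random variables with a continuously differentiable probability density $p:[-\varepsilon,\varepsilon]\to\mathbb{R}_+$ with $p(\pm\varepsilon)>0$; $p$ is extended by $0$ outside $[-\varepsilon,\varepsilon]$. The extremal maps are $f_\pm(x):=f(x)\pm\varepsilon$. A compact interval $M$ is invariant if $M=\{f(x)+\xi: x\in M,\ \xi\in[-\varepsilon,\varepsilon]\}$, and it is a minimal invariant interval if moreover it contains no proper invariant subset. The support $M=[x_-,x_+]$ of the stationary distribution is a minimal invariant interval; in particular $f_-(x_-)=x_-$ and $f_+(x_+)=x_+$. The stationary distribution on $M$ is absolutely continuous with respect to Lebesgue measure, and its density $\phi$ (the stationary density) is the fixed point of the transfer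 operator, i.e. $\phi\ge 0$, $\int_M\phi=1$ and $\phi(x)=\int_M p(x-f(y))\,\phi(y)\,dy$ for all $x\in M$. Notation: $\log^2(z)=(\log z)^2$. The term $\mathcal{O}(\log(x-x_-))$ denotes a quantity bounded in absolute value by a constant times $|\log(x-x_-)|$ for all $x>x_-$ sufficiently close to $x_-$. *)

theory Defs
  imports "HOL-Probability.Probability" "HOL-Library.Landau_Symbols"
begin

definition C2 :: "(real \<Rightarrow> real) \<Rightarrow> bool" where
  "C2 g \<longleftrightarrow> g differentiable_on UNIV \<and> deriv g differentiable_on UNIV \<and>
     continuous_on UNIV (deriv (deriv g))"

definition order_preserving_C2_diffeo :: "(real \<Rightarrow> real) \<Rightarrow> bool" where
  "order_preserving_C2_diffeo f \<longleftrightarrow> strict_mono f \<and> bij f \<and> C2 f \<and> C2 (inv f)"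

text \<open>
  The density is a total function, so it carries its extension by 0. Its derivative is taken
  within the closed interval (one-sided at the end points, where the extension jumps), which is
  why \<open>C1_differentiable_on\<close> does not apply.
\<close>

definition bounded_noise_density :: "real \<Rightarrow> (real \<Rightarrow> real) \<Rightarrow> bool" where
  "bounded_noise_density \<epsilon> p \<longleftrightarrow>
     (\<forall>x. p x \<ge> 0) \<and> (\<forall>x. x \<notin> {-\<epsilon>..\<epsilon>} \<longrightarrow> p x = 0) \<and>
     (LINT x:{-\<epsilon>..\<epsilon>}|lborel. p x) = 1 \<and>
     (\<exists>p'. (\<forall>x\<in>{-\<epsilon>..\<epsilon>}. (p has_real_derivative p' x) (at x within {-\<epsilon>..\<epsilon>})) \<and>
           continuous_on {-\<epsilon>..\<epsilon>} p') \<and>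
     p (-\<epsilon>) > 0 \<and> p \<epsilon> > 0"

definition iid_noise :: "'w measure \<Rightarrow> (nat \<Rightarrow> 'w \<Rightarrow> real) \<Rightarrow> (real \<Rightarrow> real) \<Rightarrow> bool" where
  "iid_noise P \<xi> p \<longleftrightarrow> prob_space P \<and> prob_space.indep_vars P (\<lambda>_. borel) \<xi> UNIV \<and>
     (\<forall>t. distributed P lborel (\<xi> t) (\<lambda>x. ennreal (p x)))"

text \<open>If the state has law \<open>\<mu>\<close> and is independent of the noise \<open>\<xi> t\<close>, the next state again has law \<open>\<mu>\<close>.\<close>

definition stationary_distribution ::
    "'w measure \<Rightarrow> (nat \<Rightarrow> 'w \<Rightarrow> real) \<Rightarrow> (real \<Rightarrow> real) \<Rightarrow> real measure \<Rightarrow> bool" where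
  "stationary_distribution P \<xi> f \<mu> \<longleftrightarrow> prob_space \<mu> \<and> sets \<mu> = sets borel \<and>
     (\<forall>t. distr (\<mu> \<Otimes>\<^sub>M distr P borel (\<xi> t)) borel (\<lambda>(y, z). f y + z) = \<mu>)"

definition measure_support :: "real measure \<Rightarrow> real set" where
  "measure_support \<mu> = {x. \<forall>U. open U \<and> x \<in> U \<longrightarrow> emeasure \<mu> U > 0}"

definition lower_map :: "(real \<Rightarrow> real) \<Rightarrow> real \<Rightarrow> real \<Rightarrow> real" where
  "lower_map f \<epsilon> x = f x - \<epsilon>"

text \<open>
  Invariance is a notion for nonempty compact intervals only. Allowing arbitrary subsets in the
  minimality clause would make it unsatisfiable: the empty set, and the interior of an invariant
  interval, also satisfy the set equation.
\<close>

definition invariant_interval :: "(real \<Rightarrow> real) \<Rightarrow> real \<Rightarrow> real set \<Rightarrow> bool" where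
  "invariant_interval f \<epsilon> M \<longleftrightarrow>
     (\<exists>a b. a \<le> b \<and> M = {a..b}) \<and> M = {f x + z | x z. x \<in> M \<and> z \<in> {-\<epsilon>..\<epsilon>}}"

definition minimal_invariant_interval :: "(real \<Rightarrow> real) \<Rightarrow> real \<Rightarrow> real set \<Rightarrow> bool" where
  "minimal_invariant_interval f \<epsilon> M \<longleftrightarrow>
     invariant_interval f \<epsilon> M \<and> \<not> (\<exists>N. N \<subset> M \<and> invariant_interval f \<epsilon> N)"

definition transfer_operator ::
    "(real \<Rightarrow> real) \<Rightarrow> (real \<Rightarrow> real) \<Rightarrow> real set \<Rightarrow> (real \<Rightarrow> real) \<Rightarrow> real \<Rightarrow> real" where
  "transfer_operator f p M \<phi> x = (LINT y:M|lborel. p (x - f y) * \<phi> y)"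

text \<open>
  Only the values of \<open>\<phi>\<close> on \<open>M\<close> matter. A Bochner integral with value 1 entails integrability.
  The fixed point equation holds at every point of \<open>M\<close>, which selects the version of the density.
\<close>

definition stationary_density ::
    "(real \<Rightarrow> real) \<Rightarrow> (real \<Rightarrow> real) \<Rightarrow> real set \<Rightarrow> real measure \<Rightarrow> (real \<Rightarrow> real) \<Rightarrow> bool" where
  "stationary_density f p M \<mu> \<phi> \<longleftrightarrow>
     \<mu> = density lborel (\<lambda>x. ennreal (indicator M x * \<phi> x)) \<and>
     (\<forall>x\<in>M. \<phi> x \<ge> 0) \<and> (LINT x:M|lborel. \<phi> x) = 1 \<and>
     (\<forall>x\<in>M. \<phi> x = transfer_operator f p M \<phi> x)"

end

theory Submission imports Defs begin

text \<open>
  Write \<open>g = f - \<epsilon>\<close> for the lower map, \<open>F x\<close> for the mass \<open>\<integral> \<phi>\<close> over \<open>[x\<^sub>-, x]\<close>. Noise is at least \<open>-\<epsilon>\<close>,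
  so a point \<open>x\<close> close to \<open>x\<^sub>-\<close> is reached exactly from the points \<open>y\<close> with \<open>g y \<le> x\<close>, and every such
  jump uses noise close to \<open>-\<epsilon>\<close>, where \<open>p\<close> is bounded and bounded away from 0. Hence \<open>\<phi> x\<close> equals
  \<open>F (g\<^sup>-\<^sup>1 x)\<close> up to constant factors (\<open>transfer_bounds\<close>).

  If \<open>g\<close> were linear with slope \<open>lam\<close> at \<open>x\<^sub>- = 0\<close>, this would say \<open>F' x \<approx> F (x / lam)\<close>. Integrating \<open>n\<close> times
  gives \<open>F u \<approx> A\<^sup>n u\<^sup>n / (lam ^ (n choose 2) n!)\<close> for \<open>u\<close> of order \<open>lam\<^sup>n\<close>. The logarithm of this is
  \<open>n\<^sup>2/2 ln lam - n ln n + O(n)\<close>, and \<open>n = ln u / ln lam + O(1)\<close> turns it into the claimed expansion: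
  an error of \<open>O(n)\<close> is an error of \<open>O(ln u)\<close>, which is why constant factors lost in each of the
  \<open>n\<close> integrations do no harm (\<open>cumulative_upper_bound\<close>, \<open>cumulative_lower_bound\<close>,
  \<open>ln_self_similar_asymptotics\<close>).

  The nonlinearity of \<open>g\<close> must not shift \<open>n\<close> by more than a bounded amount, so \<open>lam\<close> has to be exact.
  A linearizing coordinate would do, but one-sided versions suffice and are explicit: as \<open>g\<close> is
  \<open>C\<^sup>2\<close>, the coordinate \<open>\<psi> x = t \<plusminus> D t\<^sup>2\<close> with \<open>t = x - x\<^sub>-\<close> and \<open>D\<close> large satisfies
  \<open>\<psi> (g y) \<le> lam \<psi> y\<close> for the sign \<open>+\<close> and \<open>\<psi> (g y) \<ge> lam \<psi> y\<close> for the sign \<open>-\<close>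
  (\<open>quad_coord_cross\<close>). The first coordinate serves the lower bound on \<open>\<phi>\<close>, the second the upper bound.
\<close>

section \<open>Iterating the integral inequality\<close>

lemma FTC_power:
  fixes \<psi> \<psi>' :: "real \<Rightarrow> real"
  assumes "z \<le> x"
    and der: "\<And>y. y \<in> {z..x} \<Longrightarrow> (\<psi> has_real_derivative \<psi>' y) (at y within {z..x})"
  shows "((\<lambda>y. (\<psi> y - s) ^ n * \<psi>' y) has_integral
            ((\<psi> x - s) ^ Suc n - (\<psi> z - s) ^ Suc n) / real (Suc n)) {z..x}"
proof -
  have "((\<lambda>y. (\<psi> y - s) ^ n * \<psi>' y) has_integral
          ((\<psi> x - s) ^ Suc n / real (Suc n) - (\<psi> z - s) ^ Suc n / real (Suc n))) {z..x}"
  proof (rule fundamental_theorem_of_calculus[OF \<open>z \<le> x\<close>])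
    fix y assume y: "y \<in> {z..x}"
    have "((\<lambda>y. (\<psi> y - s) ^ Suc n / real (Suc n)) has_real_derivative
            (real (Suc n) * (\<psi> y - s) ^ n * \<psi>' y) / real (Suc n)) (at y within {z..x})"
      by (rule derivative_eq_intros der[OF y] refl | simp)+
    then show "((\<lambda>y. (\<psi> y - s) ^ Suc n / real (Suc n)) has_vector_derivative
            (\<psi> y - s) ^ n * \<psi>' y) (at y within {z..x})"
      by (simp add: has_real_derivative_iff_has_vector_derivative)
  qed
  then show ?thesis by (simp add: diff_divide_distrib)
qed

lemma strict_mono_on_of_derivative_ge:
  fixes \<psi> \<psi>' :: "real \<Rightarrow> real"
  assumes "0 < k" and "x \<in> {a..e}" "y \<in> {a..e}" "x < y"
    and der: "\<And>x. x \<in> {a..e} \<Longrightarrow> (\<psi> has_real_derivative \<psi>' x) (at x within {a..e})"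
    and k: "\<And>x. x \<in> {a..e} \<Longrightarrow> k \<le> \<psi>' x"
  shows "\<psi> x < \<psi> y"
proof -
  have sub: "{x..y} \<subseteq> {a..e}" using assms by auto
  have "\<exists>z\<in>{x..y}. \<psi> y - \<psi> x = \<psi>' z * (y - x)"
  proof (rule mvt_very_simple)
    fix z assume "x \<le> z" "z \<le> y"
    then have "(\<psi> has_real_derivative \<psi>' z) (at z within {x..y})"
      using DERIV_subset[OF der sub] sub by auto
    then show "(\<psi> has_derivative (\<lambda>h. \<psi>' z * h)) (at z within {x..y})"
      by (simp add: has_field_derivative_def)
  qed (use \<open>x < y\<close> in simp)
  then obtain z where z: "z \<in> {x..y}" "\<psi> y - \<psi> x = \<psi>' z * (y - x)" by blast
  have "0 < \<psi>' z" using k[of z] z sub \<open>0 < k\<close> by force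
  then show ?thesis using z \<open>x < y\<close> by (smt (verit) mult_pos_pos)
qed

lemma choose_two_Suc: "Suc n choose 2 = (n choose 2) + n"
  by (simp add: numeral_2_eq_2)

text \<open>
  Bookkeeping of the constants in one integration of the bounds below: the substitution \<open>\<psi> / lam\<close>
  contributes \<open>lam ^ n\<close>, the slope bound \<open>k\<close> of the coordinate enters the base of the geometric
  factor, and the power rule turns \<open>n!\<close> into \<open>(n + 1)!\<close>.
\<close>
lemma iteration_step_constant:
  fixes c k lam I X :: real
  shows "c * (I * (c / k) ^ n / lam ^ m / fact n) / lam ^ n / k * (X / real (Suc n))
           = I * (c / k) ^ Suc n / lam ^ (m + n) * X / fact (Suc n)"
  by (simp add: power_add fact_Suc divide_inverse power_mult_distrib mult_ac del: of_nat_Suc)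

text \<open>
  In the coordinate \<open>\<psi>\<close> the hypothesis \<open>rec\<close> reads \<open>F' \<le> c F(\<psi> / lam)\<close>. Starting from the trivial bound by
  the total mass, each integration over \<open>[a, x]\<close> gains one power of \<open>\<psi>\<close>. The range \<open>\<psi> x \<le> lam ^ n \<psi> e\<close> is
  exactly where \<open>n\<close> successive rescalings by \<open>1 / lam\<close> stay inside \<open>[a, e]\<close>.
\<close>
lemma cumulative_upper_bound:
  fixes \<phi> \<psi> \<psi>' :: "real \<Rightarrow> real"
  assumes lam: "0 < lam" "lam < 1" and c: "0 \<le> c" and k: "0 < k"
    and int: "\<phi> integrable_on {a..e}" and nn: "\<And>x. x \<in> {a..e} \<Longrightarrow> 0 \<le> \<phi> x"
    and der: "\<And>x. x \<in> {a..e} \<Longrightarrow> (\<psi> has_real_derivative \<psi>' x) (at x within {a..e})"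
    and kle: "\<And>x. x \<in> {a..e} \<Longrightarrow> k \<le> \<psi>' x" and psi_a: "\<psi> a = 0"
    and rec: "\<And>x y. x \<in> {a..e} \<Longrightarrow> y \<in> {a..e} \<Longrightarrow> \<psi> x = lam * \<psi> y \<Longrightarrow>
                \<phi> x \<le> c * integral {a..y} \<phi>"
    and x: "x \<in> {a..e}" "\<psi> x \<le> lam ^ n * \<psi> e"
  shows "integral {a..x} \<phi> \<le>
           integral {a..e} \<phi> * (c / k) ^ n / lam ^ (n choose 2) * \<psi> x ^ n / fact n"
  using x
proof (induction n arbitrary: x)
  case 0
  have "integral {a..x} \<phi> \<le> integral {a..e} \<phi>"
    using 0 nn int by (intro integral_subset_le) (auto intro: integrable_on_subinterval)
  then show ?case by (simp add: numeral_2_eq_2)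
next
  case (Suc n)
  have ae: "a \<le> e" using Suc.prems by auto
  have mono: "\<psi> y \<le> \<psi> z" if "y \<in> {a..e}" "z \<in> {a..e}" "y \<le> z" for y z
    using strict_mono_on_of_derivative_ge[OF k that(1,2) _ der kle] that(3)
    by (cases "y = z") auto
  have cont: "continuous_on {a..e} \<psi>"
    using der by (meson DERIV_continuous_on)
  define K where "K = integral {a..e} \<phi> * (c / k) ^ n / lam ^ (n choose 2) / fact n"
  have K0: "K \<ge> 0" unfolding K_def using lam c k nn int
    by (intro divide_nonneg_nonneg mult_nonneg_nonneg integral_nonneg) auto
  have sub: "{a..x} \<subseteq> {a..e}" using Suc.prems by auto
  have bound: "\<phi> y \<le> c * K / lam ^ n / k * ((\<psi> y - 0) ^ n * \<psi>' y)" if y: "y \<in> {a..x}" for y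
  proof -
    have yae: "y \<in> {a..e}" using y sub by auto
    have psiy0: "0 \<le> \<psi> y" using mono[of a y] yae ae psi_a by auto
    have "\<psi> y \<le> lam ^ Suc n * \<psi> e" using mono[of y x] y yae Suc.prems by auto
    then have le: "\<psi> y / lam \<le> lam ^ n * \<psi> e" using lam by (simp add: field_simps)
    also have "\<dots> \<le> \<psi> e" using lam mono[of a e] ae psi_a
      by (intro mult_left_le_one_le) (auto simp: power_le_one)
    finally obtain w where w: "w \<in> {a..e}" "\<psi> w = \<psi> y / lam"
      using IVT'[of \<psi> a "\<psi> y / lam" e] psiy0 psi_a ae cont lam by auto
    have "\<phi> y \<le> c * integral {a..w} \<phi>"
      using rec[OF yae w(1)] w lam by simp
    also have "\<dots> \<le> c * (K * \<psi> w ^ n)"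
      using Suc.IH[OF w(1)] le w(2) c unfolding K_def by (intro mult_left_mono) (simp_all add: mult_ac)
    also have "\<dots> = c * K / lam ^ n / k * (\<psi> y ^ n * k)"
      using k by (simp add: w(2) power_divide)
    also have "\<dots> \<le> c * K / lam ^ n / k * (\<psi> y ^ n * \<psi>' y)"
      using kle[OF yae] psiy0 c K0 k lam by (intro mult_left_mono) auto
    finally show ?thesis by simp
  qed
  have hi: "((\<lambda>y. c * K / lam ^ n / k * ((\<psi> y - 0) ^ n * \<psi>' y)) has_integral
          c * K / lam ^ n / k * (((\<psi> x - 0) ^ Suc n - (\<psi> a - 0) ^ Suc n) / real (Suc n))) {a..x}"
    using Suc.prems sub der
    by (intro has_integral_mult_right FTC_power) (auto intro: DERIV_subset[OF der])
  have "integral {a..x} \<phi> \<le>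
          c * K / lam ^ n / k * (((\<psi> x - 0) ^ Suc n - (\<psi> a - 0) ^ Suc n) / real (Suc n))"
    using int sub bound
    by (intro has_integral_le[OF integrable_integral hi]) (auto intro: integrable_on_subinterval)
  also have "\<dots> = integral {a..e} \<phi> * (c / k) ^ Suc n / lam ^ (Suc n choose 2) * \<psi> x ^ Suc n / fact (Suc n)"
    unfolding psi_a K_def choose_two_Suc iteration_step_constant by simp
  finally show ?case .
qed

text \<open>
  The mass of \<open>[a, x]\<close> tends to 0 as \<open>x\<close> tends to \<open>a\<close>, so the iteration starts from \<open>F \<ge> F x0\<close> to
  the right of \<open>x0\<close> and integrates only from the rescaled point \<open>\<psi> = lam ^ n \<psi> x0\<close> upwards; this
  replaces the power of \<open>\<psi> x\<close> by one of \<open>\<psi> x - lam ^ n \<psi> x0\<close>.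
\<close>
lemma cumulative_lower_bound:
  fixes \<phi> \<psi> \<psi>' :: "real \<Rightarrow> real"
  assumes lam: "0 < lam" "lam < 1" and c: "0 \<le> c" and k: "0 < k'" "0 < k"
    and int: "\<phi> integrable_on {a..e}" and nn: "\<And>x. x \<in> {a..e} \<Longrightarrow> 0 \<le> \<phi> x"
    and der: "\<And>x. x \<in> {a..e} \<Longrightarrow> (\<psi> has_real_derivative \<psi>' x) (at x within {a..e})"
    and kle: "\<And>x. x \<in> {a..e} \<Longrightarrow> k' \<le> \<psi>' x" and kge: "\<And>x. x \<in> {a..e} \<Longrightarrow> \<psi>' x \<le> k"
    and psi_a: "\<psi> a = 0"
    and rec: "\<And>x y. x \<in> {a..e} \<Longrightarrow> y \<in> {a..e} \<Longrightarrow> \<psi> x = lam * \<psi> y \<Longrightarrow>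
                c * integral {a..y} \<phi> \<le> \<phi> x"
    and x0: "x0 \<in> {a..e}"
    and x: "x \<in> {a..e}" "lam ^ n * \<psi> x0 \<le> \<psi> x" "\<psi> x \<le> lam ^ n * \<psi> e"
  shows "integral {a..x0} \<phi> * (c / k) ^ n / lam ^ (n choose 2) * (\<psi> x - lam ^ n * \<psi> x0) ^ n / fact n
           \<le> integral {a..x} \<phi>"
  using x
proof (induction n arbitrary: x)
  case 0
  then have "x0 \<le> x"
    using strict_mono_on_of_derivative_ge[OF k(1) _ x0 _ der kle, of x] by force
  then have "integral {a..x0} \<phi> \<le> integral {a..x} \<phi>"
    using 0 nn int x0 by (intro integral_subset_le) (auto intro: integrable_on_subinterval)
  then show ?case by (simp add: numeral_2_eq_2)
next
  case (Suc n)
  have ae: "a \<le> e" using Suc.prems by auto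
  have mono: "\<psi> y \<le> \<psi> z" if "y \<in> {a..e}" "z \<in> {a..e}" "y \<le> z" for y z
    using strict_mono_on_of_derivative_ge[OF k(1) that(1,2) _ der kle] that(3)
    by (cases "y = z") auto
  have cont: "continuous_on {a..e} \<psi>"
    using der by (meson DERIV_continuous_on)
  have psi0: "0 \<le> \<psi> y" if "y \<in> {a..e}" for y using mono[of a y] that ae psi_a by auto
  define K where "K = integral {a..x0} \<phi> * (c / k) ^ n / lam ^ (n choose 2) / fact n"
  have K0: "K \<ge> 0" unfolding K_def using lam c k nn int x0
    by (intro divide_nonneg_nonneg mult_nonneg_nonneg integral_nonneg)
       (auto intro: integrable_on_subinterval)
  define s where "s = lam ^ Suc n * \<psi> x0"
  have s0: "0 \<le> s" unfolding s_def using psi0[OF x0] lam by simp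
  have "continuous_on {a..x} \<psi>" using cont Suc.prems by (auto intro: continuous_on_subset)
  then obtain z where z: "a \<le> z" "z \<le> x" "\<psi> z = s"
    using IVT'[of \<psi> a s x] s0 psi_a Suc.prems unfolding s_def by auto
  have sub: "{z..x} \<subseteq> {a..e}" using Suc.prems z by auto
  have bound: "c * K / lam ^ n / k * ((\<psi> y - s) ^ n * \<psi>' y) \<le> \<phi> y" if y: "y \<in> {z..x}" for y
  proof -
    have yae: "y \<in> {a..e}" using y sub by auto
    have sy: "s \<le> \<psi> y" using mono[of z y] y yae z sub by auto
    have "\<psi> y \<le> lam ^ Suc n * \<psi> e" using mono[of y x] y yae Suc.prems by auto
    then have le: "\<psi> y / lam \<le> lam ^ n * \<psi> e" using lam by (simp add: field_simps)
    also have "\<dots> \<le> \<psi> e" using lam psi0[of e] ae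
      by (intro mult_left_le_one_le) (auto simp: power_le_one)
    finally obtain w where w: "w \<in> {a..e}" "\<psi> w = \<psi> y / lam"
      using IVT'[of \<psi> a "\<psi> y / lam" e] psi0[OF yae] psi_a ae cont lam by auto
    have sw: "(\<psi> y - s) / lam = \<psi> w - lam ^ n * \<psi> x0"
      using lam w by (simp add: s_def field_simps)
    have ge: "lam ^ n * \<psi> x0 \<le> \<psi> w" using sy lam sw
      by (metis diff_ge_0_iff_ge divide_nonneg_pos)
    have "c * K / lam ^ n / k * ((\<psi> y - s) ^ n * \<psi>' y) \<le> c * K / lam ^ n / k * ((\<psi> y - s) ^ n * k)"
      using kge[OF yae] sy c K0 k lam by (intro mult_left_mono) auto
    also have "\<dots> = c * (K * ((\<psi> y - s) / lam) ^ n)"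
      using k by (simp add: power_divide)
    also have "\<dots> \<le> c * integral {a..w} \<phi>"
      using Suc.IH[OF w(1) ge] le w(2) c unfolding K_def sw
      by (intro mult_left_mono) (simp_all add: mult_ac)
    also have "\<dots> \<le> \<phi> y"
      using rec[OF yae w(1)] w lam by simp
    finally show ?thesis .
  qed
  have hi: "((\<lambda>y. c * K / lam ^ n / k * ((\<psi> y - s) ^ n * \<psi>' y)) has_integral
          c * K / lam ^ n / k * (((\<psi> x - s) ^ Suc n - (\<psi> z - s) ^ Suc n) / real (Suc n))) {z..x}"
    using z sub der
    by (intro has_integral_mult_right FTC_power) (auto intro: DERIV_subset[OF der])
  have "integral {a..x0} \<phi> * (c / k) ^ Suc n / lam ^ (Suc n choose 2) *
          (\<psi> x - lam ^ Suc n * \<psi> x0) ^ Suc n / fact (Suc n)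
        = c * K / lam ^ n / k * (((\<psi> x - s) ^ Suc n - (\<psi> z - s) ^ Suc n) / real (Suc n))"
    unfolding K_def choose_two_Suc z(3) s_def[symmetric] iteration_step_constant by simp
  also have "\<dots> \<le> integral {z..x} \<phi>"
    using int sub bound
    by (intro has_integral_le[OF hi integrable_integral]) (auto intro: integrable_on_subinterval)
  also have "\<dots> \<le> integral {a..x} \<phi>"
    using Suc.prems nn int z sub by (intro integral_subset_le) (auto intro: integrable_on_subinterval)
  finally show ?case .
qed

section \<open>Logarithm of the iterated bounds\<close>

lemma ln_fact_ge: "real n * ln (real n) - real n \<le> ln (fact n)"
proof (cases "n = 0")
  case False
  have "real n ^ n / fact n \<le> exp (real n)"
  proof -
    have "(\<Sum>k\<in>{n}. inverse (fact k) * real n ^ k) \<le> (\<Sum>k. inverse (fact k) * real n ^ k)"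
      by (rule sum_le_suminf[OF summable_exp]) auto
    then show ?thesis by (simp add: exp_def divide_inverse mult.commute)
  qed
  then have "real n ^ n \<le> exp (real n) * fact n" by (simp add: field_simps)
  then have "ln (real n ^ n) \<le> ln (exp (real n) * fact n)" using False
    by (subst ln_le_cancel_iff) auto
  then show ?thesis using False by (simp add: ln_mult ln_realpow)
qed simp

lemma ln_fact_le: "ln (fact n) \<le> real n * ln (real n)"
proof (cases "n = 0")
  case False
  have "(fact n :: real) \<le> real n ^ n"
    by (metis fact_le_power of_nat_power)
  then have "ln (fact n :: real) \<le> ln (real n ^ n)" using False
    by (subst ln_le_cancel_iff) auto
  then show ?thesis using False by (simp add: ln_realpow)
qed simp

lemma choose_two_real: "real (n choose 2) = real n * (real n - 1) / 2"
  by (induction n) (simp_all add: choose_two_Suc numeral_2_eq_2 field_simps )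

definition main_term :: "real \<Rightarrow> real \<Rightarrow> real" where
  "main_term lam t = 1 / (2 * ln lam) * (ln t)\<^sup>2 - 2 / (2 * ln lam) * ln t * ln (ln (1 / t))"

text \<open>
  The number \<open>n\<close> of iterations is tied to the scale by \<open>n = ln t / ln lam + O(1)\<close>. Hence \<open>n\<^sup>2 / 2\<close> and
  \<open>n ln n\<close> may be replaced by the corresponding expressions in \<open>ln t\<close> at the cost of \<open>O(ln t)\<close>, and
  Stirling's formula is needed only in the form \<open>ln n! = n ln n + O(n)\<close>.
\<close>
lemma ln_self_similar_asymptotics:
  assumes lam: "0 < lam" "lam < 1" and "0 < d" "0 < A" "0 < B" "1 \<le> k"
  obtains C t0 where "0 < t0" "t0 < 1"
    "\<And>t u n. 0 < t \<Longrightarrow> t < t0 \<Longrightarrow> t / k \<le> u \<Longrightarrow> u \<le> k * t \<Longrightarrow>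
       lam ^ Suc n * d < u \<Longrightarrow> u \<le> lam ^ n * d \<Longrightarrow>
       \<bar>ln (B * A ^ n / lam ^ (n choose 2) * u ^ n / fact n) - main_term lam t\<bar> \<le> C * \<bar>ln t\<bar>"
proof -
  define l where "l = - ln lam"
  have l: "l > 0" "ln lam = - l" using lam by (auto simp: l_def)
  define R where "R = \<bar>ln d\<bar> + l + ln k"
  have R: "R > 0" using l \<open>1 \<le> k\<close> unfolding R_def by (smt (verit) ln_ge_zero)
  \<comment> \<open>Beyond this threshold \<open>M = - ln t\<close> dominates \<open>R\<close> and \<open>l\<close>, so that \<open>N > 1\<close> and \<open>N l\<close> is comparable to \<open>M\<close>.\<close>
  define M0 where "M0 = 2 * R + 2 * l + 1"
  define q where "q = \<bar>ln A\<bar> + l / 2 + R + 1 + \<bar>ln l\<bar> + ln 2"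
  define C where "C = \<bar>ln B\<bar> + 2 / l * q + R * 3 / (2 * l) + R / l"
  show ?thesis
  proof (rule that[of "exp (- M0)" C])
    show "0 < exp (- M0)" by simp
    show "exp (- M0) < 1" using l R by (simp add: M0_def)
    fix t u :: real and n :: nat
    assume t: "0 < t" "t < exp (- M0)" and tu: "t / k \<le> u" "u \<le> k * t"
      and un: "lam ^ Suc n * d < u" "u \<le> lam ^ n * d"
    define M where "M = - ln t"
    define N where "N = real n"
    have "ln t < - M0" using t by (metis ln_less_cancel_iff ln_exp exp_gt_zero)
    then have M: "M > 2 * R + 2 * l + 1" by (simp add: M_def M0_def)
    have u: "u > 0" using t tu \<open>1 \<le> k\<close>
      by (smt (verit, best) zero_less_divide_iff)
    define e where "e = ln u + N * l"
    have "ln (lam ^ Suc n * d) < ln u" using un(1) u lam \<open>0 < d\<close> by (subst ln_less_cancel_iff) auto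
    then have e1: "- (l + \<bar>ln d\<bar>) \<le> e"
      using lam \<open>0 < d\<close> l unfolding e_def N_def
      by (simp add: ln_mult ln_realpow algebra_simps)
    have "ln u \<le> ln (lam ^ n * d)" using un(2) u lam \<open>0 < d\<close> by (subst ln_le_cancel_iff) auto
    then have e2: "e \<le> \<bar>ln d\<bar>"
      using lam \<open>0 < d\<close> l unfolding e_def N_def
      by (simp add: ln_mult ln_realpow algebra_simps)
    have "ln (t / k) \<le> ln u" using tu u t \<open>1 \<le> k\<close> by (subst ln_le_cancel_iff) auto
    then have tu1: "- M - ln k \<le> ln u" using t \<open>1 \<le> k\<close> by (simp add: ln_div M_def)
    have "ln u \<le> ln (k * t)" using tu u t \<open>1 \<le> k\<close> by (subst ln_le_cancel_iff) auto
    then have tu2: "ln u \<le> - M + ln k" using t \<open>1 \<le> k\<close> by (simp add: ln_mult M_def)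
    have lnk: "0 \<le> ln k" using \<open>1 \<le> k\<close> by simp
    have eR: "\<bar>e\<bar> \<le> R" using e1 e2 lnk l by (auto simp: R_def)
    have MN: "\<bar>M - N * l\<bar> \<le> R" using e1 e2 tu1 tu2 l(1) unfolding R_def e_def by linarith
    have Nl: "M / 2 \<le> N * l" "N * l \<le> 2 * M" using MN M R l by linarith+
    have "N * l > l" using Nl M R l by linarith
    then have N1: "N > 1" using l by simp
    have NM: "N \<le> 2 / l * M" using Nl l by (simp add: field_simps)
    have M1: "M > 1" using M R l by linarith
    have lnT: "ln (B * A ^ n / lam ^ (n choose 2) * u ^ n / fact n)
                 = ln B + N * ln A + N * (N - 1) / 2 * l + N * ln u - ln (fact n)"
      using lam \<open>0 < A\<close> \<open>0 < B\<close> u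
      by (simp add: ln_mult ln_div ln_realpow choose_two_real N_def l(2))
    define f where "f = N * ln N - ln (fact n)"
    have f: "\<bar>f\<bar> \<le> N" using ln_fact_ge[of n] ln_fact_le[of n] by (simp add: f_def N_def)
    have main: "main_term lam t = - M\<^sup>2 / (2 * l) - M / l * ln M"
      using t l by (simp add: main_term_def M_def ln_div)
    have "M / N \<le> 2 * l" "l / 2 \<le> M / N" using Nl N1 by (simp_all add: field_simps)
    then have "ln (M / N) \<le> ln (2 * l)" "ln (l / 2) \<le> ln (M / N)"
      using M1 N1 l by (subst ln_le_cancel_iff; auto)+
    then have lnMN: "\<bar>ln M - ln N\<bar> \<le> \<bar>ln l\<bar> + ln 2"
      using M1 N1 l by (simp add: ln_mult ln_div)
    have lnM: "0 \<le> ln M" "ln M \<le> M" using M1 ln_le_minus_one[of M] by auto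
    \<comment> \<open>The errors \<open>e\<close>, \<open>f\<close>, \<open>M - N l\<close> and \<open>ln M - ln N\<close> are bounded by \<open>R\<close>, \<open>N\<close>, \<open>R\<close> and a constant.\<close>
    have diff: "ln (B * A ^ n / lam ^ (n choose 2) * u ^ n / fact n) - main_term lam t
        = ln B + (N * (ln A - l / 2 + e) + f + N * (ln M - ln N))
          + (M - N * l) * (M + N * l) / (2 * l) + (M - N * l) / l * ln M"
    proof -
      have lu: "ln u = e - N * l" and lf: "ln (fact n) = N * ln N - f"
        by (simp_all add: e_def f_def)
      show ?thesis unfolding lnT main lu lf using l(1) by (simp add: field_simps power2_eq_square)
    qed
    have b1: "\<bar>ln B\<bar> \<le> \<bar>ln B\<bar> * M" using M1 by (simp add: mult_le_cancel_left1)
    have b2: "\<bar>N * (ln A - l / 2 + e) + f + N * (ln M - ln N)\<bar> \<le> N * q"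
    proof -
      have "\<bar>N * (ln A - l / 2 + e)\<bar> \<le> N * (\<bar>ln A\<bar> + l / 2 + R)"
        unfolding abs_mult using N1 eR l by (intro mult_mono) auto
      moreover have "\<bar>N * (ln M - ln N)\<bar> \<le> N * (\<bar>ln l\<bar> + ln 2)"
        unfolding abs_mult using N1 lnMN by (intro mult_mono) auto
      ultimately show ?thesis using f unfolding q_def by (simp add: algebra_simps)
    qed
    have "q \<ge> 0" using l R unfolding q_def by simp
    then have b3: "N * q \<le> 2 / l * q * M" using mult_right_mono[OF NM, of q] by (simp add: mult_ac)
    have b4: "\<bar>(M - N * l) * (M + N * l) / (2 * l)\<bar> \<le> R * 3 / (2 * l) * M"
    proof -
      have "\<bar>(M - N * l) * (M + N * l)\<bar> \<le> R * (3 * M)"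
        unfolding abs_mult using MN Nl M1 R by (intro mult_mono) auto
      then have "\<bar>(M - N * l) * (M + N * l)\<bar> / (2 * l) \<le> R * (3 * M) / (2 * l)"
        using l by (intro divide_right_mono) auto
      then show ?thesis using l by simp
    qed
    have b5: "\<bar>(M - N * l) / l * ln M\<bar> \<le> R / l * M"
      unfolding abs_mult using MN lnM l R
      by (intro mult_mono) (auto simp: divide_right_mono)
    have "\<bar>ln (B * A ^ n / lam ^ (n choose 2) * u ^ n / fact n) - main_term lam t\<bar> \<le> C * M"
    proof -
      have tri: "\<bar>a + b + c + d\<bar> \<le> \<bar>a\<bar> + \<bar>b\<bar> + \<bar>c\<bar> + \<bar>d\<bar>" for a b c d :: real
        by linarith
      show ?thesis unfolding diff C_def distrib_right
        by (rule order_trans[OF tri]) (intro add_mono b1 b4 b5 order_trans[OF b2 b3])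
    qed
    then show "\<bar>ln (B * A ^ n / lam ^ (n choose 2) * u ^ n / fact n) - main_term lam t\<bar> \<le> C * \<bar>ln t\<bar>"
      using M1 by (simp add: M_def)
  qed
qed

section \<open>Quadratic coordinates near the fixed point\<close>

text \<open>
  A second-order substitute for the coordinate that linearizes the lower map at its fixed point \<open>a\<close>.
\<close>
definition quad_coord :: "real \<Rightarrow> real \<Rightarrow> real \<Rightarrow> real" where
  "quad_coord D a x = (x - a) + D * (x - a)\<^sup>2"

lemma quad_coord_base [simp]: "quad_coord D a a = 0"
  by (simp add: quad_coord_def)

lemma has_derivative_quad_coord:
  "(quad_coord D a has_real_derivative 1 + 2 * D * (x - a)) (at x within S)"
  unfolding quad_coord_def[abs_def] by (auto intro!: derivative_eq_intros)

text \<open>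
  All later use of the coordinate is on an interval so short that its slope stays in \<open>[1/2, 3/2]\<close>.
\<close>
lemma slope_quad_coord:
  fixes D a e x :: real
  assumes "\<bar>D\<bar> * (e - a) \<le> 1 / 4" "x \<in> {a..e}"
  shows "1 / 2 \<le> 1 + 2 * D * (x - a)" "1 + 2 * D * (x - a) \<le> 3 / 2"
proof -
  have "\<bar>D * (x - a)\<bar> \<le> \<bar>D\<bar> * (e - a)"
    using assms(2) unfolding abs_mult by (intro mult_left_mono) auto
  then have "\<bar>D * (x - a)\<bar> \<le> 1 / 4" using assms(1) by linarith
  then show "1 / 2 \<le> 1 + 2 * D * (x - a)" "1 + 2 * D * (x - a) \<le> 3 / 2"
    by (auto simp: abs_le_iff)
qed

lemma quad_coord_bounds:
  assumes "\<bar>D\<bar> * (e - a) \<le> 1 / 4" "x \<in> {a..e}"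
  shows "(x - a) / 2 \<le> quad_coord D a x" "quad_coord D a x \<le> 2 * (x - a)"
proof -
  have "\<bar>D * (x - a)\<bar> \<le> \<bar>D\<bar> * (e - a)"
    using assms(2) unfolding abs_mult by (intro mult_left_mono) auto
  then have "\<bar>D * (x - a)\<bar> \<le> 1 / 4" using assms(1) by linarith
  then have "\<bar>D * (x - a) * (x - a)\<bar> \<le> 1 / 4 * (x - a)"
    using assms(2) unfolding abs_mult by (intro mult_mono) auto
  moreover define t w where "t = x - a" and "w = D * (x - a) * (x - a)"
  moreover have "quad_coord D a x = t + w" "0 \<le> t"
    using assms(2) by (auto simp: t_def w_def quad_coord_def power2_eq_square)
  ultimately have "\<bar>w\<bar> \<le> 1 / 4 * t" "quad_coord D a x = t + w" "0 \<le> t" by auto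
  then have "t / 2 \<le> quad_coord D a x \<and> quad_coord D a x \<le> 2 * t" by linarith
  then show "(x - a) / 2 \<le> quad_coord D a x" "quad_coord D a x \<le> 2 * (x - a)"
    by (simp_all add: t_def)
qed

lemma quad_coord_strict_mono:
  assumes "\<bar>D\<bar> * (e - a) \<le> 1 / 4" "x \<in> {a..e}" "y \<in> {a..e}" "x < y"
  shows "quad_coord D a x < quad_coord D a y"
  using strict_mono_on_of_derivative_ge[OF _ assms(2-4) has_derivative_quad_coord]
    slope_quad_coord(1)[OF assms(1)] by (meson half_gt_zero zero_less_one)

lemma geometric_level_exists:
  fixes lam u \<delta> :: real
  assumes "0 < lam" "lam < 1" "0 < u" "u \<le> \<delta>"
  obtains n where "lam ^ Suc n * \<delta> < u" "u \<le> lam ^ n * \<delta>"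
proof -
  have d: "\<delta> > 0" using assms by simp
  define m where "m = (LEAST m. lam ^ m * \<delta> < u)"
  obtain m0 where "lam ^ m0 < u / \<delta>"
    using real_arch_pow_inv[of "u / \<delta>" lam] assms d by auto
  then have ex: "lam ^ m0 * \<delta> < u" using d by (simp add: field_simps)
  have m: "lam ^ m * \<delta> < u" unfolding m_def using ex by (rule LeastI)
  then obtain n where n: "m = Suc n" using assms by (cases m) auto
  have "\<not> lam ^ n * \<delta> < u"
    using not_less_Least[of n "\<lambda>m. lam ^ m * \<delta> < u"] n unfolding m_def by simp
  then show thesis using that[of n] m n by simp
qed

text \<open>
  Both asymptotic bounds pass from \<open>x\<close> to the point \<open>y\<close> whose coordinate is larger by the factor \<open>1 / lam\<close>,
  and read off from the size of \<open>\<psi> y\<close> how many times the integral inequality is to be iterated.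
\<close>
lemma preimage_level:
  assumes lam: "0 < lam" "lam < 1" and D: "\<bar>D\<bar> * (e - a) \<le> 1 / 4"
    and x: "a < x" "x \<le> e" and small: "quad_coord D a x \<le> lam * quad_coord D a e"
  obtains y n where "y \<in> {a..e}" "quad_coord D a x = lam * quad_coord D a y"
    "lam ^ Suc n * quad_coord D a e < quad_coord D a y" "quad_coord D a y \<le> lam ^ n * quad_coord D a e"
    "(x - a) / (2 / lam) \<le> quad_coord D a y" "quad_coord D a y \<le> 2 / lam * (x - a)"
proof -
  let ?\<psi> = "quad_coord D a"
  note b = quad_coord_bounds[OF D, of x]
  have pos: "0 < ?\<psi> x" using b x by auto
  have le: "?\<psi> x / lam \<le> ?\<psi> e" using small lam by (simp add: field_simps)
  obtain y where y: "y \<in> {a..e}" "?\<psi> y = ?\<psi> x / lam"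
    using IVT'[of ?\<psi> a "?\<psi> x / lam" e] le pos lam x
      DERIV_continuous_on[OF has_derivative_quad_coord, of "{a..e}"] by auto
  have "0 < ?\<psi> y" "?\<psi> y \<le> ?\<psi> e" using y(2) pos lam le by auto
  then obtain n where "lam ^ Suc n * ?\<psi> e < ?\<psi> y" "?\<psi> y \<le> lam ^ n * ?\<psi> e"
    using geometric_level_exists[OF lam] by blast
  moreover have "(x - a) / (2 / lam) \<le> ?\<psi> y"
  proof -
    have "(x - a) / (2 / lam) = lam * ((x - a) / 2)" by simp
    also have "\<dots> \<le> 1 * ?\<psi> x" using b x lam by (intro mult_mono) auto
    also have "\<dots> \<le> ?\<psi> x / lam" using pos lam by (simp add: field_simps)
    finally show ?thesis using y by simp
  qed
  moreover have "?\<psi> y \<le> 2 / lam * (x - a)"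
    unfolding y(2) using b x lam by (simp add: divide_right_mono)
  ultimately show thesis using that y lam by simp
qed

lemma eventually_at_right_small:
  fixes a :: real
  assumes "\<And>x. a < x \<Longrightarrow> x < a + t1 \<Longrightarrow> P x" "0 < t1"
  shows "eventually P (at_right a)"
  unfolding eventually_at_right_field using assms by (intro exI[of _ "a + t1"]) auto

lemma density_asymptotic_upper:
  fixes \<phi> :: "real \<Rightarrow> real"
  assumes lam: "0 < lam" "lam < 1" and ae: "a < e" and D: "\<bar>D\<bar> * (e - a) \<le> 1 / 4"
    and int: "\<phi> integrable_on {a..e}" and nn: "\<And>x. x \<in> {a..e} \<Longrightarrow> 0 \<le> \<phi> x"
    and mass: "0 < integral {a..e} \<phi>" and c: "0 < c"
    and rec: "\<And>x y. x \<in> {a..e} \<Longrightarrow> y \<in> {a..e} \<Longrightarrow> quad_coord D a x = lam * quad_coord D a y \<Longrightarrow>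
                \<phi> x \<le> c * integral {a..y} \<phi>"
    and pos: "eventually (\<lambda>x. 0 < \<phi> x) (at_right a)"
  shows "\<exists>C. eventually (\<lambda>x. ln (\<phi> x) - main_term lam (x - a) \<le> C * \<bar>ln (x - a)\<bar>) (at_right a)"
proof -
  let ?\<psi> = "quad_coord D a"
  have psie: "0 < ?\<psi> e" using quad_coord_bounds(1)[OF D, of e] ae by auto
  have k: "1 \<le> 2 / lam" using lam by simp
  define A where "A = c / (1 / 2)"
  define B where "B = c * integral {a..e} \<phi>"
  have AB: "0 < A" "0 < B" using c mass by (auto simp: A_def B_def)
  obtain C t0 where t0: "0 < t0" "t0 < 1" and C:
    "\<And>t u n. 0 < t \<Longrightarrow> t < t0 \<Longrightarrow> t / (2 / lam) \<le> u \<Longrightarrow> u \<le> 2 / lam * t \<Longrightarrow>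
       lam ^ Suc n * ?\<psi> e < u \<Longrightarrow> u \<le> lam ^ n * ?\<psi> e \<Longrightarrow>
       \<bar>ln (B * A ^ n / lam ^ (n choose 2) * u ^ n / fact n) - main_term lam t\<bar> \<le> C * \<bar>ln t\<bar>"
    by (rule ln_self_similar_asymptotics[OF lam psie AB k]) blast
  define t1 where "t1 = min (min t0 (e - a)) (lam * ?\<psi> e / 2)"
  have "eventually (\<lambda>x. 0 < \<phi> x \<longrightarrow> ln (\<phi> x) - main_term lam (x - a) \<le> C * \<bar>ln (x - a)\<bar>) (at_right a)"
  proof (rule eventually_at_right_small)
    show "0 < t1" using t0 ae lam psie by (simp add: t1_def)
    fix x assume x: "a < x" "x < a + t1"
    then have xe: "x \<le> e" and xt: "x - a < t0" and "2 * (x - a) \<le> lam * ?\<psi> e"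
      by (auto simp: t1_def)
    then have small: "?\<psi> x \<le> lam * ?\<psi> e" using quad_coord_bounds(2)[OF D, of x] x by auto
    obtain y n where y: "y \<in> {a..e}" "?\<psi> x = lam * ?\<psi> y"
      and n: "lam ^ Suc n * ?\<psi> e < ?\<psi> y" "?\<psi> y \<le> lam ^ n * ?\<psi> e"
      and xy: "(x - a) / (2 / lam) \<le> ?\<psi> y" "?\<psi> y \<le> 2 / lam * (x - a)"
      using preimage_level[OF lam D x(1) xe small] by metis
    have "\<phi> x \<le> c * integral {a..y} \<phi>" using rec[OF _ y] x xe by auto
    also have "\<dots> \<le> c * (integral {a..e} \<phi> * (c / (1 / 2)) ^ n / lam ^ (n choose 2) * ?\<psi> y ^ n / fact n)"
      using c
      by (intro mult_left_mono cumulative_upper_bound[OF lam _ _ int nn has_derivative_quad_coord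
            slope_quad_coord(1)[OF D] _ rec y(1) n(2)]) auto
    also have "\<dots> = B * A ^ n / lam ^ (n choose 2) * ?\<psi> y ^ n / fact n"
      by (simp add: A_def B_def mult_ac)
    finally have "ln (\<phi> x) \<le> ln (B * A ^ n / lam ^ (n choose 2) * ?\<psi> y ^ n / fact n)" if "0 < \<phi> x"
      using that ln_mono by blast
    then show "0 < \<phi> x \<longrightarrow> ln (\<phi> x) - main_term lam (x - a) \<le> C * \<bar>ln (x - a)\<bar>"
      using C[OF _ xt xy n] x by force
  qed
  with pos have "eventually (\<lambda>x. ln (\<phi> x) - main_term lam (x - a) \<le> C * \<bar>ln (x - a)\<bar>) (at_right a)"
    by eventually_elim simp
  then show ?thesis by blast
qed

text \<open>
  The point \<open>x0\<close> from which the lower iteration starts is chosen with \<open>\<psi> x0 = lam \<psi> e / 2\<close>: on the level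
  \<open>lam ^ Suc n \<psi> e < \<psi> y\<close> this makes \<open>\<psi> y - lam ^ n \<psi> x0\<close> at least \<open>\<psi> y / 2\<close>, so the shift costs
  only another geometric factor \<open>2 ^ n\<close>.
\<close>
lemma density_asymptotic_lower:
  fixes \<phi> :: "real \<Rightarrow> real"
  assumes lam: "0 < lam" "lam < 1" and ae: "a < e" and D: "\<bar>D\<bar> * (e - a) \<le> 1 / 4"
    and int: "\<phi> integrable_on {a..e}" and nn: "\<And>x. x \<in> {a..e} \<Longrightarrow> 0 \<le> \<phi> x"
    and mass: "\<And>x. a < x \<Longrightarrow> x \<le> e \<Longrightarrow> 0 < integral {a..x} \<phi>" and c: "0 < c"
    and rec: "\<And>x y. x \<in> {a..e} \<Longrightarrow> y \<in> {a..e} \<Longrightarrow> quad_coord D a x = lam * quad_coord D a y \<Longrightarrow>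
                c * integral {a..y} \<phi> \<le> \<phi> x"
  shows "\<exists>C. eventually (\<lambda>x. 0 < \<phi> x \<and> - C * \<bar>ln (x - a)\<bar> \<le> ln (\<phi> x) - main_term lam (x - a)) (at_right a)"
proof -
  let ?\<psi> = "quad_coord D a"
  have psie: "0 < ?\<psi> e" using quad_coord_bounds(1)[OF D, of e] ae by auto
  have k: "1 \<le> 2 / lam" using lam by simp
  have "lam * ?\<psi> e \<le> 1 * ?\<psi> e" using lam psie by (intro mult_right_mono) auto
  then have "lam * ?\<psi> e / 2 \<le> ?\<psi> e" using psie by simp
  then obtain x0 where x0: "x0 \<in> {a..e}" "?\<psi> x0 = lam * ?\<psi> e / 2"
    using IVT'[of ?\<psi> a "lam * ?\<psi> e / 2" e] psie lam ae
      DERIV_continuous_on[OF has_derivative_quad_coord, of "{a..e}"] by auto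
  have "x0 \<noteq> a" using x0(2) lam psie by auto
  then have mass0: "0 < integral {a..x0} \<phi>" using mass x0 by auto
  define A where "A = c / (3 / 2) / 2"
  define B where "B = c * integral {a..x0} \<phi>"
  have AB: "0 < A" "0 < B" using c mass0 by (auto simp: A_def B_def)
  obtain C t0 where t0: "0 < t0" "t0 < 1" and C:
    "\<And>t u n. 0 < t \<Longrightarrow> t < t0 \<Longrightarrow> t / (2 / lam) \<le> u \<Longrightarrow> u \<le> 2 / lam * t \<Longrightarrow>
       lam ^ Suc n * ?\<psi> e < u \<Longrightarrow> u \<le> lam ^ n * ?\<psi> e \<Longrightarrow>
       \<bar>ln (B * A ^ n / lam ^ (n choose 2) * u ^ n / fact n) - main_term lam t\<bar> \<le> C * \<bar>ln t\<bar>"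
    by (rule ln_self_similar_asymptotics[OF lam psie AB k]) blast
  define t1 where "t1 = min (min t0 (e - a)) (lam * ?\<psi> e / 2)"
  have "eventually (\<lambda>x. 0 < \<phi> x \<and> - C * \<bar>ln (x - a)\<bar> \<le> ln (\<phi> x) - main_term lam (x - a)) (at_right a)"
  proof (rule eventually_at_right_small)
    show "0 < t1" using t0 ae lam psie by (simp add: t1_def)
    fix x assume x: "a < x" "x < a + t1"
    then have xe: "x \<le> e" and xt: "x - a < t0" and "2 * (x - a) \<le> lam * ?\<psi> e"
      by (auto simp: t1_def)
    then have small: "?\<psi> x \<le> lam * ?\<psi> e" using quad_coord_bounds(2)[OF D, of x] x by auto
    obtain y n where y: "y \<in> {a..e}" "?\<psi> x = lam * ?\<psi> y"
      and n: "lam ^ Suc n * ?\<psi> e < ?\<psi> y" "?\<psi> y \<le> lam ^ n * ?\<psi> e"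
      and xy: "(x - a) / (2 / lam) \<le> ?\<psi> y" "?\<psi> y \<le> 2 / lam * (x - a)"
      using preimage_level[OF lam D x(1) xe small] by metis
    have psiy: "0 < ?\<psi> y" using n(1) lam psie
      by (meson less_trans mult_pos_pos zero_less_power)
    have half: "?\<psi> y / 2 \<le> ?\<psi> y - lam ^ n * ?\<psi> x0" using n(1) by (simp add: x0(2) mult_ac)
    have ge: "lam ^ n * ?\<psi> x0 \<le> ?\<psi> y" using half psiy by linarith
    define T where "T = B * A ^ n / lam ^ (n choose 2) * ?\<psi> y ^ n / fact n"
    have T0: "0 < T" using AB lam psiy by (simp add: T_def)
    have "T = c * (integral {a..x0} \<phi> * (c / (3 / 2)) ^ n / lam ^ (n choose 2) * (?\<psi> y / 2) ^ n / fact n)"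
      by (simp add: T_def A_def B_def power_divide power_mult_distrib)
    also have "\<dots> \<le> c * (integral {a..x0} \<phi> * (c / (3 / 2)) ^ n / lam ^ (n choose 2) * (?\<psi> y - lam ^ n * ?\<psi> x0) ^ n / fact n)"
      using c mass0 lam half psiy
      by (intro mult_left_mono divide_right_mono power_mono) auto
    also have "\<dots> \<le> c * integral {a..y} \<phi>"
      using c
      by (intro mult_left_mono cumulative_lower_bound[OF lam _ _ _ int nn has_derivative_quad_coord
            slope_quad_coord[OF D] _ rec x0(1) y(1) ge n(2)]) auto
    also have "\<dots> \<le> \<phi> x" using rec[OF _ y] x xe by auto
    finally have "T \<le> \<phi> x" .
    then have "0 < \<phi> x" "ln T \<le> ln (\<phi> x)" using T0 by auto
    then show "0 < \<phi> x \<and> - C * \<bar>ln (x - a)\<bar> \<le> ln (\<phi> x) - main_term lam (x - a)"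
      using C[OF _ xt xy n] x unfolding T_def by force
  qed
  then show ?thesis by blast
qed

text \<open>
  The point \<open>z\<close> stands for the image of \<open>y\<close> under a map with fixed point \<open>a\<close> and derivative \<open>lam\<close> there. The
  remainder \<open>K t\<^sup>2\<close> is absorbed because the quadratic term \<open>D t\<^sup>2\<close> of the coordinate is contracted by
  \<open>lam\<^sup>2\<close>, that is, more strongly than by \<open>lam\<close>: the gain is \<open>D lam (1 - lam) t\<^sup>2\<close>. The factor 2 in
  \<open>D\<close> leaves room for the terms of higher order.
\<close>
lemma quad_coord_cross:
  assumes lam: "0 < lam" "lam < 1" and K: "0 \<le> K" and Ke: "K * (e - a) \<le> lam * (1 - lam) / 8"
    and D_def: "D = 2 * K / (lam * (1 - lam))"
    and y: "y \<in> {a..e}"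
    and g: "\<bar>z - a - lam * (y - a)\<bar> \<le> K * (y - a)\<^sup>2"
  shows "a \<le> z" "z \<le> e"
    "lam * quad_coord (- D) a y \<le> quad_coord (- D) a (z)"
    "quad_coord D a (z) \<le> lam * quad_coord D a y"
proof -
  define t where "t = y - a"
  define G where "G = z - a"
  have t: "0 \<le> t" "t \<le> e - a" using y by (auto simp: t_def)
  have D0: "0 \<le> D" using lam K by (simp add: D_def)
  have KD: "2 * K = D * (lam * (1 - lam))" using lam by (simp add: D_def)
  define q where "q = K * t"
  have q0: "0 \<le> q" using K t by (simp add: q_def)
  have q1: "q \<le> lam * (1 - lam) / 8"
    using mult_left_mono[OF t(2) K] Ke by (simp add: q_def)
  have "D * (lam * (1 - lam)) * t = 2 * q" using KD by (simp add: q_def)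
  then have "(D * t) * (lam * (1 - lam)) \<le> 1 / 4 * (lam * (1 - lam))" using q1 by (simp add: mult_ac)
  moreover have ll: "0 < lam * (1 - lam)" using lam by simp
  ultimately have Dt: "D * t \<le> 1 / 4" by (meson mult_le_cancel_right_pos)
  have l1: "lam * (1 - lam) \<le> lam" "lam * (1 - lam) \<le> 1 - lam" using lam
    by (simp_all add: mult_le_cancel_left1 mult_le_cancel_right1)
  have G: "(lam - q) * t \<le> G" "G \<le> (lam + q) * t"
    using g by (auto simp: abs_le_iff G_def[symmetric] t_def[symmetric] q_def power2_eq_square algebra_simps)
  have ql: "q \<le> lam" "q \<le> 1 - lam" using q1 l1 lam by linarith+
  have w0: "0 \<le> (lam - q) * t" using ql t by simp
  have w1: "(lam + q) * t \<le> 1 * t" using ql t by (intro mult_right_mono) auto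
  have G0: "0 \<le> G" "G \<le> t" using G w0 w1 by auto
  show "a \<le> z" "z \<le> e" using G0 t by (auto simp: G_def)
  show "lam * quad_coord (- D) a y \<le> quad_coord (- D) a (z)"
  proof -
    define w where "w = (lam - q) * t"
    have wG: "w \<le> G" "0 \<le> w" using G w0 by (auto simp: w_def)
    have wl: "w \<le> lam * t" using q0 t by (auto simp: w_def left_diff_distrib)
    have "D * (w + G) \<le> D * (2 * t)" using D0 wG G0 by (intro mult_left_mono) auto
    then have "D * (w + G) \<le> 1" using Dt by simp
    then have "0 \<le> (G - w) * (1 - D * (w + G))" using wG by simp
    then have 1: "w - D * w\<^sup>2 \<le> G - D * G\<^sup>2" by (simp add: power2_eq_square algebra_simps)
    have 2: "D * w\<^sup>2 \<le> D * (lam * t)\<^sup>2" using wl wG D0 by (intro mult_left_mono power_mono) auto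
    have "lam * (t - D * t\<^sup>2) = w - D * (lam * t)\<^sup>2 - K * t\<^sup>2"
    proof -
      have "2 * K * (t * t) = D * (lam * (1 - lam)) * (t * t)" using KD by simp
      then show ?thesis unfolding w_def q_def by (simp add: power2_eq_square algebra_simps)
    qed
    moreover have "0 \<le> K * t\<^sup>2" using K by simp
    ultimately have "lam * (t - D * t\<^sup>2) \<le> G - D * G\<^sup>2" using 1 2 by linarith
    then show ?thesis by (simp add: quad_coord_def t_def G_def)
  qed
  show "quad_coord D a (z) \<le> lam * quad_coord D a y"
  proof -
    have "D * G\<^sup>2 \<le> D * ((lam + q) * t)\<^sup>2" using D0 G G0 by (intro mult_left_mono power_mono) auto
    moreover have "(lam + q)\<^sup>2 \<le> lam * (1 + lam) / 2"
    proof -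
      have "q * q \<le> q * lam" using ql q0 by (intro mult_left_mono) auto
      then have "(lam + q)\<^sup>2 \<le> lam * lam + 3 * lam * q" by (simp add: power2_eq_square algebra_simps)
      also have "lam * lam + 3 * lam * q \<le> lam * lam + 3 * (lam * (1 - lam) / 8)"
        using q1 lam q0 mult_right_mono[of lam 1 q] by linarith
      also have "lam * lam + 3 * (lam * (1 - lam) / 8) \<le> lam * (1 + lam) / 2"
      proof -
        have "s + 3 * ((lam - s) / 8) \<le> (lam + s) / 2" if "0 < lam - s" for s
          using that by (simp add: field_simps)
        from this[of "lam * lam"] show ?thesis
          using ll by (simp only: distrib_left right_diff_distrib mult_1_right)
      qed
      finally show ?thesis by simp
    qed
    then have "D * (t\<^sup>2 * (lam + q)\<^sup>2) \<le> D * (t\<^sup>2 * (lam * (1 + lam) / 2))"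
      using D0 by (intro mult_left_mono) auto
    moreover have "(lam + q) * t + D * (t\<^sup>2 * (lam * (1 + lam) / 2)) = lam * (t + D * t\<^sup>2)"
    proof -
      have "2 * K * (t * t) = D * (lam * (1 - lam)) * (t * t)" using KD by simp
      then show ?thesis unfolding q_def by (simp add: power2_eq_square field_simps)
    qed
    ultimately have "G + D * G\<^sup>2 \<le> lam * (t + D * t\<^sup>2)"
      using G by (simp add: power_mult_distrib mult.commute)
    then show ?thesis by (simp add: quad_coord_def t_def G_def)
  qed
qed

section \<open>The lower map at the left end point\<close>

lemma C2_quadratic_remainder:
  assumes "C2 f"
  obtains K where "0 \<le> K"
    "\<And>y. y \<in> {a..a + 1} \<Longrightarrow> \<bar>f y - f a - deriv f a * (y - a)\<bar> \<le> K * (y - a)\<^sup>2"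
proof -
  have d1: "(f has_real_derivative deriv f x) (at x)"
   and d2: "(deriv f has_real_derivative deriv (deriv f) x) (at x)" for x
    using assms unfolding C2_def differentiable_on_def
    by (auto simp: DERIV_deriv_iff_real_differentiable)
  have "continuous_on {a..a+1} (deriv (deriv f))"
    using assms unfolding C2_def by (auto intro: continuous_on_subset)
  then have "bounded (deriv (deriv f) ` {a..a+1})"
    by (intro compact_imp_bounded compact_continuous_image) auto
  then obtain K where K: "\<And>x. x \<in> {a..a+1} \<Longrightarrow> \<bar>deriv (deriv f) x\<bar> \<le> K"
    by (metis bounded_iff image_eqI real_norm_def)
  show thesis
  proof (rule that[of K])
    show "0 \<le> K" using K[of a] by auto
    fix y assume y: "y \<in> {a..a+1}"
    show "\<bar>f y - f a - deriv f a * (y - a)\<bar> \<le> K * (y - a)\<^sup>2"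
    proof (cases "y = a")
      case False
      then have ay: "a < y" using y by auto
      obtain z where z: "a < z" "z < y" "f y - f a = (y - a) * deriv f z"
        using MVT2[OF ay] d1 by metis
      obtain w where w: "a < w" "w < z" "deriv f z - deriv f a = (z - a) * deriv (deriv f) w"
        using MVT2[OF z(1)] d2 by metis
      have "f y - f a - deriv f a * (y - a) = (y - a) * ((z - a) * deriv (deriv f) w)"
        unfolding z w(3)[symmetric] by (simp add: algebra_simps)
      also have "\<bar>\<dots>\<bar> \<le> (y - a) * ((y - a) * K)"
        unfolding abs_mult using ay z w y K[of w] by (intro mult_mono) auto
      finally show ?thesis by (simp add: power2_eq_square mult_ac)
    qed simp
  qed
qed

lemma deriv_pos_of_diffeo:
  assumes "order_preserving_C2_diffeo f"
  shows "0 < deriv f x"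
proof -
  have f: "strict_mono f" "bij f" "C2 f" "C2 (inv f)"
    using assms by (auto simp: order_preserving_C2_diffeo_def)
  have d: "(h has_real_derivative deriv h x) (at x)" if "C2 h" for h x
    using that unfolding C2_def differentiable_on_def
    by (auto simp: DERIV_deriv_iff_real_differentiable)
  have "((\<lambda>x. inv f (f x)) has_real_derivative deriv (inv f) (f x) * deriv f x) (at x)"
    by (rule DERIV_chain2[OF d[OF f(4)] d[OF f(3)]])
  moreover have "(\<lambda>x. inv f (f x)) = (\<lambda>x. x)" using f(2) by (simp add: bij_is_inj)
  ultimately have "deriv (inv f) (f x) * deriv f x = 1"
    using DERIV_unique[OF _ DERIV_ident] by fastforce
  then have "deriv f x \<noteq> 0" by auto
  moreover have "0 \<le> deriv f x"
    using f(1) by (intro mono_on_imp_deriv_nonneg[OF _ d[OF f(3)], of UNIV])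
      (auto simp: strict_mono_mono mono_on_def mono_def strict_mono_less_eq)
  ultimately show ?thesis by simp
qed

text \<open>
  The left end point is attained as \<open>f x + z\<close>, and by monotonicity no such value is smaller than \<open>f a - \<epsilon>\<close>.
\<close>
lemma minimal_invariant_interval_endpoints:
  assumes "minimal_invariant_interval f \<epsilon> {a..b}" "strict_mono f" "0 < \<epsilon>"
  shows "a < b" "f a = a + \<epsilon>"
proof -
  have inv: "{a..b} = {f x + z | x z. x \<in> {a..b} \<and> z \<in> {-\<epsilon>..\<epsilon>}}" and ex: "\<exists>c d. c \<le> d \<and> {a..b} = {c..d}"
    using assms(1) unfolding minimal_invariant_interval_def invariant_interval_def by blast+
  have ab: "a \<le> b" using ex by (metis atLeastatMost_empty_iff)
  have img: "f x + z \<in> {a..b}" if "x \<in> {a..b}" "z \<in> {-\<epsilon>..\<epsilon>}" for x z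
    using inv that by blast
  have "a \<in> {f x + z | x z. x \<in> {a..b} \<and> z \<in> {-\<epsilon>..\<epsilon>}}"
    using ab by (intro subsetD[OF equalityD1[OF inv]]) simp
  then obtain x z where xz: "x \<in> {a..b}" "z \<in> {-\<epsilon>..\<epsilon>}" "a = f x + z" by blast
  have "f a \<le> f x" using assms(2) xz(1) by (simp add: strict_mono_less_eq)
  moreover have "f a + (-\<epsilon>) \<in> {a..b}" "f a + \<epsilon> \<in> {a..b}" using ab assms(3) by (intro img; simp)+
  ultimately show "f a = a + \<epsilon>" "a < b" using xz assms(3) by auto
qed

section \<open>The stationary density and its cumulative mass\<close>

lemma bounded_noise_density_bounds:
  assumes p: "bounded_noise_density \<epsilon> p" and eps: "0 < \<epsilon>"
  obtains c1 c2 \<eta> where "0 < c1" "0 < c2" "0 < \<eta>" "\<eta> \<le> 2 * \<epsilon>"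
    "\<And>x. p x \<le> c2" "\<And>x. - \<epsilon> \<le> x \<Longrightarrow> x \<le> - \<epsilon> + \<eta> \<Longrightarrow> c1 \<le> p x"
proof -
  obtain p' where p': "\<And>x. x \<in> {-\<epsilon>..\<epsilon>} \<Longrightarrow> (p has_real_derivative p' x) (at x within {-\<epsilon>..\<epsilon>})"
    using p unfolding bounded_noise_density_def by blast
  have cont: "continuous_on {-\<epsilon>..\<epsilon>} p" using p' by (rule DERIV_continuous_on)
  then have "bounded (p ` {-\<epsilon>..\<epsilon>})"
    by (intro compact_imp_bounded compact_continuous_image) auto
  then obtain B where B: "\<forall>x\<in>{-\<epsilon>..\<epsilon>}. \<bar>p x\<bar> \<le> B" unfolding bounded_iff by auto
  have out: "\<And>x. x \<notin> {-\<epsilon>..\<epsilon>} \<Longrightarrow> p x = 0" and pm: "0 < p (-\<epsilon>)"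
    using p unfolding bounded_noise_density_def by auto
  have c2: "p x \<le> max B 1" for x
    using B out[of x] by (cases "x \<in> {-\<epsilon>..\<epsilon>}") (auto simp: abs_le_iff le_max_iff_disj)
  have "\<forall>e>0. \<exists>d>0. \<forall>x'\<in>{-\<epsilon>..\<epsilon>}. dist x' (-\<epsilon>) < d \<longrightarrow> dist (p x') (p (-\<epsilon>)) < e"
    using cont eps unfolding continuous_on_iff by auto
  then obtain d where d: "d > 0"
    "\<And>x. x \<in> {-\<epsilon>..\<epsilon>} \<Longrightarrow> dist x (-\<epsilon>) < d \<Longrightarrow> dist (p x) (p (-\<epsilon>)) < p (-\<epsilon>) / 2"
    using pm by (meson half_gt_zero)
  show thesis
  proof (rule that[of "p (-\<epsilon>) / 2" "max B 1" "min (d / 2) (2 * \<epsilon>)"])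
    fix x assume x: "- \<epsilon> \<le> x" "x \<le> - \<epsilon> + min (d / 2) (2 * \<epsilon>)"
    then have "dist (p x) (p (-\<epsilon>)) < p (-\<epsilon>) / 2" using d(1) by (intro d(2)) (auto simp: dist_real_def)
    then show "p (-\<epsilon>) / 2 \<le> p x" unfolding dist_real_def by linarith
  qed (use pm d(1) eps c2 in auto)
qed

lemma noise_density_measurable:
  assumes "bounded_noise_density \<epsilon> p"
  shows "p \<in> borel_measurable borel"
proof -
  have "(LINT x:{-\<epsilon>..\<epsilon>}|lborel. p x) = 1" and out: "\<And>x. x \<notin> {-\<epsilon>..\<epsilon>} \<Longrightarrow> p x = 0"
    using assms unfolding bounded_noise_density_def by auto
  then have "integrable lborel (\<lambda>x. indicator {-\<epsilon>..\<epsilon>} x *\<^sub>R p x)"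
    unfolding set_lebesgue_integral_def using not_integrable_integral_eq by fastforce
  then have "(\<lambda>x. indicator {-\<epsilon>..\<epsilon>} x *\<^sub>R p x) \<in> borel_measurable borel"
    using borel_measurable_integrable by fastforce
  moreover have "(\<lambda>x. indicator {-\<epsilon>..\<epsilon>} x *\<^sub>R p x) = p"
    using out by (auto simp: indicator_def fun_eq_iff)
  ultimately show ?thesis by simp
qed

lemma stationary_density_integrable:
  assumes "stationary_density f p {a..b} \<mu> \<phi>"
  shows "set_integrable lborel {a..b} \<phi>"
  using assms not_integrable_integral_eq
  unfolding stationary_density_def set_lebesgue_integral_def set_integrable_def by fastforce

text \<open>
  Here the support of \<open>\<mu>\<close> enters: its left end point is charged by every neighbourhood, so \<open>\<phi>\<close> cannot vanish
  near \<open>a\<close>. This starts the lower iteration.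
\<close>
lemma stationary_density_mass_pos:
  assumes dens: "stationary_density f p {a..b} \<mu> \<phi>" and supp: "measure_support \<mu> = {a..b}"
    and x: "a < x" "x \<le> b"
  shows "0 < integral {a..x} \<phi>"
proof -
  have int: "set_integrable lborel {a..x} \<phi>"
    using stationary_density_integrable[OF dens] x by (rule_tac set_integrable_subset) auto
  have \<mu>: "\<mu> = density lborel (\<lambda>x. ennreal (indicator {a..b} x * \<phi> x))"
    and nn: "\<And>x. x \<in> {a..b} \<Longrightarrow> 0 \<le> \<phi> x"
    using dens unfolding stationary_density_def by auto
  have meas: "(\<lambda>x. indicator {a..b} x * \<phi> x) \<in> borel_measurable borel"
    using borel_measurable_integrable[OF stationary_density_integrable[OF dens, unfolded set_integrable_def]]
    by simp
  have "a \<in> measure_support \<mu>" using supp x by simp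
  then have "0 < emeasure \<mu> {..<x}" unfolding measure_support_def using x by auto
  also have "emeasure \<mu> {..<x} = (\<integral>\<^sup>+z. ennreal (indicator {a..b} z * \<phi> z) * indicator {..<x} z \<partial>lborel)"
    unfolding \<mu> using meas by (subst emeasure_density) auto
  also have "\<dots> \<le> (\<integral>\<^sup>+z. ennreal (indicator {a..x} z *\<^sub>R \<phi> z) \<partial>lborel)"
    by (intro nn_integral_mono) (auto simp: indicator_def)
  also have "\<dots> = ennreal (LINT z:{a..x}|lborel. \<phi> z)"
    unfolding set_lebesgue_integral_def
    using int nn x by (intro nn_integral_eq_integral AE_I2) (auto simp: set_integrable_def indicator_def)
  finally show ?thesis
    using set_borel_integral_eq_integral(2)[OF int] by simp
qed

text \<open>
  If \<open>x \<le> g y\<close>, the kernel \<open>p (x - f z)\<close> vanishes for \<open>z > y\<close>. If \<open>g y \<le> x\<close>, then for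
  \<open>z \<le> y\<close> the kernel is evaluated within \<open>x - a\<close> of the end point \<open>-\<epsilon>\<close>, because \<open>f z \<ge> f a = a + \<epsilon>\<close>.
\<close>
lemma transfer_bounds:
  fixes f p \<phi> :: "real \<Rightarrow> real"
  assumes dens: "stationary_density f p {a..b} \<mu> \<phi>" and f: "strict_mono f" and fa: "f a = a + \<epsilon>"
    and eps: "0 < \<epsilon>" and p: "bounded_noise_density \<epsilon> p"
    and y: "a \<le> y" "y \<le> b" and x: "x \<in> {a..b}"
  shows "\<And>c. (\<And>z. p z \<le> c) \<Longrightarrow> x \<le> f y - \<epsilon> \<Longrightarrow> \<phi> x \<le> c * integral {a..y} \<phi>"
    and "\<And>c. (\<And>z. - \<epsilon> \<le> z \<Longrightarrow> z \<le> - \<epsilon> + (x - a) \<Longrightarrow> c \<le> p z) \<Longrightarrow> f y - \<epsilon> \<le> x \<Longrightarrow> c * integral {a..y} \<phi> \<le> \<phi> x"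
proof -
  have int: "set_integrable lborel {a..b} \<phi>" by (rule stationary_density_integrable[OF dens])
  have inty: "set_integrable lborel {a..y} \<phi>"
    using int y by (rule_tac set_integrable_subset) auto
  have nn: "\<And>x. x \<in> {a..b} \<Longrightarrow> 0 \<le> \<phi> x"
    using dens unfolding stationary_density_def by auto
  have pnn: "\<And>z. 0 \<le> p z" and out: "\<And>z. z \<notin> {-\<epsilon>..\<epsilon>} \<Longrightarrow> p z = 0"
    using p unfolding bounded_noise_density_def by auto
  have fm: "f \<in> borel_measurable borel"
    using f by (intro borel_measurable_mono strict_mono_mono)
  have pm: "p \<in> borel_measurable borel" by (rule noise_density_measurable[OF p])
  have Fy: "c * integral {a..y} \<phi> = (LINT z|lborel. c * (indicator {a..y} z *\<^sub>R \<phi> z))" for c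
    using set_borel_integral_eq_integral(2)[OF inty] by (simp add: set_lebesgue_integral_def)
  have inty': "integrable lborel (\<lambda>z. c * (indicator {a..y} z *\<^sub>R \<phi> z))" for c
    using inty unfolding set_integrable_def by (intro integrable_mult_right)
  obtain B where B: "\<And>z. p z \<le> B"
    using bounded_noise_density_bounds[OF p eps] by metis
  have intx: "integrable lborel (\<lambda>z. indicator {a..b} z *\<^sub>R (p (x - f z) * \<phi> z))"
  proof (rule Bochner_Integration.integrable_bound)
    have i: "integrable lborel (\<lambda>z. indicator {a..b} z *\<^sub>R \<phi> z)" using int by (simp add: set_integrable_def)
    then show "integrable lborel (\<lambda>z. B * (indicator {a..b} z *\<^sub>R \<phi> z))" by (rule integrable_mult_right)
    have "(\<lambda>z. p (x - f z) * (indicator {a..b} z *\<^sub>R \<phi> z)) \<in> borel_measurable lborel"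
      using fm pm borel_measurable_integrable[OF i] by measurable
    then show "(\<lambda>z. indicator {a..b} z *\<^sub>R (p (x - f z) * \<phi> z)) \<in> borel_measurable lborel"
      by (simp add: mult_ac)
    show "AE z in lborel. norm (indicator {a..b} z *\<^sub>R (p (x - f z) * \<phi> z)) \<le> norm (B * (indicator {a..b} z *\<^sub>R \<phi> z))"
      using pnn B order_trans[OF pnn B]
      by (intro AE_I2) (auto simp: indicator_def abs_mult intro!: mult_right_mono)
  qed
  have \<phi>: "\<phi> x = (LINT z|lborel. indicator {a..b} z *\<^sub>R (p (x - f z) * \<phi> z))"
    using dens x unfolding stationary_density_def transfer_operator_def set_lebesgue_integral_def by blast
  show "\<phi> x \<le> c * integral {a..y} \<phi>" if c: "\<And>z. p z \<le> c" and xy: "x \<le> f y - \<epsilon>" for c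
  proof -
    have "indicator {a..b} z *\<^sub>R (p (x - f z) * \<phi> z) \<le> c * (indicator {a..y} z *\<^sub>R \<phi> z)" for z
    proof (cases "y < z")
      case True
      then have "f y < f z" using f by (simp add: strict_mono_less)
      then have "x - f z \<notin> {-\<epsilon>..\<epsilon>}" using xy by auto
      then show ?thesis using True out by simp
    next
      case False
      then show ?thesis using y nn c by (auto simp: indicator_def intro!: mult_right_mono)
    qed
    then show ?thesis unfolding \<phi> Fy by (intro integral_mono intx inty')
  qed
  show "c * integral {a..y} \<phi> \<le> \<phi> x"
    if c: "\<And>z. - \<epsilon> \<le> z \<Longrightarrow> z \<le> - \<epsilon> + (x - a) \<Longrightarrow> c \<le> p z" and xy: "f y - \<epsilon> \<le> x" for c
  proof -
    have "c * (indicator {a..y} z *\<^sub>R \<phi> z) \<le> indicator {a..b} z *\<^sub>R (p (x - f z) * \<phi> z)" for z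
    proof (cases "z \<in> {a..y}")
      case True
      then have "f z \<le> f y" "f a \<le> f z" using f by (simp_all add: strict_mono_less_eq)
      then have "c \<le> p (x - f z)" using xy fa by (intro c) auto
      then show ?thesis using True y nn by (auto simp: indicator_def intro!: mult_right_mono)
    next
      case False
      then show ?thesis using nn pnn by (auto simp: indicator_def)
    qed
    then show ?thesis unfolding \<phi> Fy by (intro integral_mono intx inty')
  qed
qed

section \<open>Asymptotics of the stationary density\<close>

theorem theorem2p2:
  fixes f p \<phi> :: "real \<Rightarrow> real" and \<epsilon> xm xp lam :: real
    and P :: "'w measure" and \<xi> :: "nat \<Rightarrow> 'w \<Rightarrow> real" and \<mu> :: "real measure"
  assumes "\<epsilon> > 0"
    and "order_preserving_C2_diffeo f"
    and "bounded_noise_density \<epsilon> p"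
    and "iid_noise P \<xi> p"
    and "stationary_distribution P \<xi> f \<mu>"
    and "measure_support \<mu> = {xm..xp}"
    and "minimal_invariant_interval f \<epsilon> {xm..xp}"
    and "stationary_density f p {xm..xp} \<mu> \<phi>"
    and "\<exists>U. open U \<and> xm \<in> U \<and>
           (mono_on U (deriv (lower_map f \<epsilon>)) \<or> antimono_on U (deriv (lower_map f \<epsilon>)))"
    and "lam = deriv (lower_map f \<epsilon>) xm"
    and "lam < 1"
    and "p (-\<epsilon>) > 0"
  shows "(\<lambda>x. ln (\<phi> x) -
            (1 / (2 * ln lam) * (ln (x - xm))\<^sup>2
             - 2 / (2 * ln lam) * ln (x - xm) * ln (ln (1 / (x - xm)))))
         \<in> O[at_right xm](\<lambda>x. ln (x - xm))"
proof -
  note eps = assms(1) and p = assms(3) and dens = assms(8)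
  have f: "strict_mono f" and C2: "C2 f" using assms(2) by (auto simp: order_preserving_C2_diffeo_def)
  have xmp: "xm < xp" and fxm: "f xm = xm + \<epsilon>"
    using minimal_invariant_interval_endpoints[OF assms(7) f eps] .
  have lam_f: "lam = deriv f xm"
  proof -
    have "(f has_real_derivative deriv f xm) (at xm)"
      using C2 by (simp add: C2_def differentiable_on_def DERIV_deriv_iff_real_differentiable)
    then have "(lower_map f \<epsilon> has_real_derivative deriv f xm) (at xm)"
      unfolding lower_map_def[abs_def] by (auto intro!: derivative_eq_intros)
    then show ?thesis using assms(10) DERIV_imp_deriv by blast
  qed
  have lam: "0 < lam" "lam < 1" using deriv_pos_of_diffeo[OF assms(2)] lam_f assms(11) by auto
  obtain c1 c2 \<eta> where c: "0 < c1" "0 < c2" "0 < \<eta>" "\<eta> \<le> 2 * \<epsilon>"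
    and c2: "\<And>x. p x \<le> c2" and c1: "\<And>x. - \<epsilon> \<le> x \<Longrightarrow> x \<le> - \<epsilon> + \<eta> \<Longrightarrow> c1 \<le> p x"
    using bounded_noise_density_bounds[OF p eps] by metis
  obtain K where K: "0 \<le> K"
    and remainder: "\<And>y. y \<in> {xm..xm + 1} \<Longrightarrow> \<bar>f y - f xm - deriv f xm * (y - xm)\<bar> \<le> K * (y - xm)\<^sup>2"
    using C2_quadratic_remainder[OF C2] by metis
  define D where "D = 2 * K / (lam * (1 - lam))"
  \<comment> \<open>Short enough to stay in \<open>M\<close>, to keep the noise where \<open>p \<ge> c1\<close>, and for both quadratic coordinates.\<close>
  define h where "h = min (min 1 (xp - xm)) (min \<eta> (lam * (1 - lam) / 8 / (K + 1)))"
  define e where "e = xm + h"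
  have ll: "0 < lam * (1 - lam)" using lam by simp
  have h: "0 < h" "h \<le> 1" "h \<le> xp - xm" "h \<le> \<eta>" "h \<le> lam * (1 - lam) / 8 / (K + 1)"
    using xmp c K ll by (auto simp: h_def)
  have Ke: "K * (e - xm) \<le> lam * (1 - lam) / 8"
  proof -
    have "K * h \<le> (K + 1) * (lam * (1 - lam) / 8 / (K + 1))" using h K by (intro mult_mono) auto
    also have "\<dots> = lam * (1 - lam) / 8" using K by (simp del: divide_divide_eq_left)
    finally show ?thesis by (simp add: e_def)
  qed
  have "D * (e - xm) = 2 * (K * (e - xm)) / (lam * (1 - lam))" by (simp add: D_def)
  also have "\<dots> \<le> 2 * (lam * (1 - lam) / 8) / (lam * (1 - lam))"
    using Ke ll by (intro divide_right_mono mult_left_mono) auto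
  finally have De: "\<bar>D\<bar> * (e - xm) \<le> 1 / 4" "\<bar>- D\<bar> * (e - xm) \<le> 1 / 4"
    using ll K lam by (auto simp: D_def)
  have e: "xm < e" "e \<le> xp" "e \<le> xm + \<eta>" "e \<le> xm + 1" using h by (auto simp: e_def)
  have cross: "xm \<le> lower_map f \<epsilon> y" "lower_map f \<epsilon> y \<le> e"
    "lam * quad_coord (- D) xm y \<le> quad_coord (- D) xm (lower_map f \<epsilon> y)"
    "quad_coord D xm (lower_map f \<epsilon> y) \<le> lam * quad_coord D xm y" if "y \<in> {xm..e}" for y
  proof -
    have "\<bar>lower_map f \<epsilon> y - xm - lam * (y - xm)\<bar> \<le> K * (y - xm)\<^sup>2"
      using remainder[of y] that e fxm lam_f by (simp add: lower_map_def algebra_simps)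
    from quad_coord_cross[OF lam K Ke D_def that this]
    show "xm \<le> lower_map f \<epsilon> y" "lower_map f \<epsilon> y \<le> e"
      "lam * quad_coord (- D) xm y \<le> quad_coord (- D) xm (lower_map f \<epsilon> y)"
      "quad_coord D xm (lower_map f \<epsilon> y) \<le> lam * quad_coord D xm y" by auto
  qed
  have int: "\<phi> integrable_on {xm..e}"
    using set_borel_integral_eq_integral(1)[OF stationary_density_integrable[OF dens]] e
    by (auto intro: integrable_on_subinterval)
  have nn: "0 \<le> \<phi> x" if "x \<in> {xm..e}" for x
    using dens that e unfolding stationary_density_def by auto
  have mass: "0 < integral {xm..x} \<phi>" if "xm < x" "x \<le> e" for x
    using stationary_density_mass_pos[OF dens assms(6)] that e by auto
  have upper: "\<phi> x \<le> c2 * integral {xm..y} \<phi>"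
    if "x \<in> {xm..e}" "y \<in> {xm..e}" "quad_coord (- D) xm x = lam * quad_coord (- D) xm y" for x y
  proof -
    have "x \<le> lower_map f \<epsilon> y"
      using quad_coord_strict_mono[OF De(2), of "lower_map f \<epsilon> y" x] cross[OF that(2)] that by force
    then show ?thesis
      using transfer_bounds(1)[OF dens f fxm eps p _ _ _ c2, of y x] that e by (auto simp: lower_map_def)
  qed
  have lower: "c1 * integral {xm..y} \<phi> \<le> \<phi> x"
    if "x \<in> {xm..e}" "y \<in> {xm..e}" "quad_coord D xm x = lam * quad_coord D xm y" for x y
  proof -
    have "lower_map f \<epsilon> y \<le> x"
      using quad_coord_strict_mono[OF De(1), of x "lower_map f \<epsilon> y"] cross[OF that(2)] that by force
    then show ?thesis
      using that e c1 by (intro transfer_bounds(2)[OF dens f fxm eps p]) (auto simp: lower_map_def)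
  qed
  obtain Cl where Cl: "eventually (\<lambda>x. 0 < \<phi> x \<and>
      - Cl * \<bar>ln (x - xm)\<bar> \<le> ln (\<phi> x) - main_term lam (x - xm)) (at_right xm)"
    using density_asymptotic_lower[OF lam e(1) De(1) int nn mass c(1) lower] by blast
  then have "eventually (\<lambda>x. 0 < \<phi> x) (at_right xm)" by eventually_elim simp
  then obtain Cu where Cu: "eventually (\<lambda>x.
      ln (\<phi> x) - main_term lam (x - xm) \<le> Cu * \<bar>ln (x - xm)\<bar>) (at_right xm)"
    using density_asymptotic_upper[OF lam e(1) De(2) int nn _ c(2) upper] mass[OF e(1)] by blast
  from Cl Cu have "eventually (\<lambda>x. norm (ln (\<phi> x) - main_term lam (x - xm))
      \<le> max Cl Cu * norm (ln (x - xm))) (at_right xm)"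
  proof eventually_elim
    case (elim x)
    have "Cl * \<bar>ln (x - xm)\<bar> \<le> max Cl Cu * \<bar>ln (x - xm)\<bar>"
      "Cu * \<bar>ln (x - xm)\<bar> \<le> max Cl Cu * \<bar>ln (x - xm)\<bar>" by (auto intro: mult_right_mono)
    then show ?case using elim by (auto simp: abs_le_iff)
  qed
  then show ?thesis unfolding main_term_def by (rule bigoI)
qed

end
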